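(* Let $\mu$ be a probabilistic frame for $\mathbb{R}^n$ with frame operator ${\bf S}_\mu$, and let $T:\mathbb{R}^n\to\mathbb{R}^n$ be a measurable map such that $T_\#\mu$ is a probabilistic dual frame of pushforward type for $\mu$ (i.e. $T_\#\mu\in\mathcal{P}_2(\mathbb{R}^n)$ and $\int_{\mathbb{R}^n}{\bf x}\,T({\bf x})^t\,d\mu({\bf x})={\bf Id}$). Then $$\int_{\mathbb{R}^n}\int_{\mathbb{R}^n}|\langle {\bf x},T({\bf y})\rangle|^2\,d\mu({\bf x})\,d\mu({\bf y})\ \geq\ n,$$ and equality holds if and only if $T({\bf y})={\bf S}_\mu^{-1}{\bf y}$ for $\mu$-almost all ${\bf y}\in\mathbb{R}^n$.
   Context: $\mathcal{P}(\mathbb{R}^n)$ is the set of Borel probability measures on $\mathbb{R}^n$, and $\mathcal{P}_2(\mathbb{R}^n)$ is the subset of those $\mu$ with $\int\|{\bf x}\|^2d\mu({\bf x})<\infty$. A measure $\mu\in\mathcal{P}(\mathbb{R}^n)$ is a probabilistic frame for $\mathbb{R}^n$ if there exist $0<A\le B<\infty$ with $A\|{\bf x}\|^2\le\int_{\mathbb{R}^n}|\langle{\bf x},{\bf y}\rangle|^2d\mu({\bf y})\le B\|{\bf x}\|^2$ for all ${\bf x}\in\mathbb{R}^n$. Its frame operator is the matrix ${\bf S}_\mu=\int_{\mathbb{R}^n}{\bf y}{\bf y}^t\,d\mu({\bf y})$, which is positive definite (hence invertible). $T_\#\mu$ denotes the pushforward measure $E\mapsto\mu(T^{-1}(E))$;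 ${\bf Id}$ is the $n\times n$ identity matrix. The double integral in the claim is called the probabilistic dual frame potential $\mathrm{PDFP}_\mu(T_\#\mu)$. *)

theory Defs
  imports "HOL-Probability.Probability"
begin

definition borel_prob_measures :: "('a::euclidean_space) measure set" where
  "borel_prob_measures = {\<mu>. prob_space \<mu> \<and> sets \<mu> = sets borel}"

definition borel_prob_measures2 :: "('a::euclidean_space) measure set" where
  "borel_prob_measures2 =
     {\<mu> \<in> borel_prob_measures. (\<integral>\<^sup>+ x. ennreal ((norm x)\<^sup>2) \<partial>\<mu>) < \<infinity>}"

(* Integrals of nonnegative functions are taken in ennreal, so that a divergent
   integral is infinite rather than 0 (the Bochner convention): in particular the
   upper frame bound really asserts finiteness. *)
definition probabilistic_frame :: "('a::euclidean_space) measure \<Rightarrow> bool" where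
  "probabilistic_frame \<mu> \<longleftrightarrow>
     \<mu> \<in> borel_prob_measures \<and>
     (\<exists>A B :: real. 0 < A \<and> A \<le> B \<and>
        (\<forall>x. ennreal (A * (norm x)\<^sup>2) \<le> (\<integral>\<^sup>+ y. ennreal (\<bar>x \<bullet> y\<bar>\<^sup>2) \<partial>\<mu>) \<and>
             (\<integral>\<^sup>+ y. ennreal (\<bar>x \<bullet> y\<bar>\<^sup>2) \<partial>\<mu>) \<le> ennreal (B * (norm x)\<^sup>2)))"

(* The n x n matrix x y^t.  The annotations are essential: columnvector and rowvector
   repeat the vector over an arbitrary index type, which here must be the type 1. *)
definition outer_prod :: "real ^ 'n \<Rightarrow> real ^ 'n \<Rightarrow> real ^ 'n ^ ('n::finite)" where
  "outer_prod x y = (columnvector x :: real ^ 1 ^ 'n) ** (rowvector y :: real ^ 'n ^ 1)"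

(* Matrix-valued Bochner integral.  The integrand is integrable whenever
   \<mu> is a probabilistic frame, since \<mu> then has finite second moment. *)
definition frame_operator :: "(real ^ 'n) measure \<Rightarrow> real ^ 'n ^ ('n::finite)" where
  "frame_operator \<mu> = (\<integral> y. outer_prod y y \<partial>\<mu>)"

(* The pushforward of \<mu> under T is a probabilistic dual frame of \<mu>.  Integrability of
   the matrix-valued integrand need not be required: a non-integrable function has
   Bochner integral 0, which differs from the identity matrix. *)
definition pushforward_dual_frame ::
    "(real ^ 'n) measure \<Rightarrow> (real ^ 'n \<Rightarrow> real ^ ('n::finite)) \<Rightarrow> bool" where
  "pushforward_dual_frame \<mu> T \<longleftrightarrow>
     distr \<mu> borel T \<in> borel_prob_measures2 \<and>
     (\<integral> x. outer_prod x (T x) \<partial>\<mu>) = mat 1"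

end

theory Submission
  imports Defs
begin

text \<open>
  The inner integral of the potential is the quadratic form of the frame operator \<open>S\<close> at
  \<open>T y\<close>, so the potential is \<open>\<integral> T y \<bullet> S (T y)\<close>, and the theorem is a matter of completing the
  square around the canonical dual \<open>S\<^sup>-\<^sup>1 y\<close>:
  \[ T y \bullet S (T y) = 2 (T y \bullet y) - y \bullet S^{-1} y + h \bullet S h,
     \quad h = T y - S^{-1} y. \]
  The first two terms integrate to constants that do not depend on \<open>T\<close>. Indeed \<open>T y \<bullet> y\<close> is the
  trace of the outer product whose integral is the identity by duality, so it integrates to
  \<open>n\<close>; and \<open>y \<bullet> S\<^sup>-\<^sup>1 y\<close> is the trace of \<open>S\<^sup>-\<^sup>1 (y y\<^sup>t)\<close>, so it integrates to the trace of
  \<open>S\<^sup>-\<^sup>1 S\<close>, again \<open>n\<close>. Hence the potential is \<open>n\<close> plus the integral of \<open>h \<bullet> S h\<close>. Since the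
  lower frame bound makes \<open>S\<close> positive definite, this remainder is nonnegative, and it
  vanishes exactly when \<open>h = 0\<close> almost everywhere.
\<close>

section \<open>Outer products\<close>

lemma outer_prod_nth: "outer_prod x y $ i $ j = x $ i * y $ j"
  by (simp add: outer_prod_def matrix_matrix_mult_def columnvector_def rowvector_def)

lemma norm_outer_prod: "norm (outer_prod x y) = norm x * norm y"
proof -
  have row: "outer_prod x y $ i = x $ i *\<^sub>R y" for i
    by (simp add: vec_eq_iff outer_prod_nth)
  show ?thesis
    unfolding norm_vec_def[of "outer_prod x y"] row norm_scaleR
    by (simp add: L2_set_left_distrib[symmetric] norm_vec_def[of x])
qed

lemma outer_prod_mult_vec: "outer_prod x y *v z = (y \<bullet> z) *\<^sub>R x"
  by (simp add: vec_eq_iff matrix_vector_mult_def outer_prod_nth inner_vec_def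
      sum_distrib_right sum_distrib_left mult_ac)

lemma trace_outer_prod: "trace (outer_prod x y) = x \<bullet> y"
  by (simp add: trace_def outer_prod_nth inner_vec_def)

lemma trace_mult_outer_prod: "trace (M ** outer_prod x y) = y \<bullet> (M *v x)"
  by (simp add: trace_def matrix_matrix_mult_def matrix_vector_mult_def outer_prod_nth
      inner_vec_def sum_distrib_left mult_ac)

lemma continuous_on_outer_prod_self:
  fixes A :: "(real ^ 'n) set"
  shows "continuous_on A (\<lambda>y. outer_prod y y)"
proof -
  have "(\<lambda>y :: real ^ 'n. outer_prod y y) = (\<lambda>y. \<chi> i j. y $ i * y $ j)"
    by (simp add: fun_eq_iff vec_eq_iff outer_prod_nth)
  then show ?thesis
    by (simp only:) (intro continuous_intros)
qed

lemma bounded_linear_trace_mult: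
  "bounded_linear (\<lambda>X :: real ^ 'n ^ 'n. trace (M ** X))"
  unfolding linear_conv_bounded_linear[symmetric]
  by (rule linearI)
    (simp_all add: trace_def matrix_matrix_mult_def sum.distrib sum_distrib_left algebra_simps)

lemma bounded_linear_trace: "bounded_linear (trace :: real ^ 'n ^ 'n \<Rightarrow> real)"
  using bounded_linear_trace_mult[of "mat 1"] by simp

lemma bounded_linear_bilinear_form:
  "bounded_linear (\<lambda>X :: real ^ 'n ^ 'n. u \<bullet> (X *v v))"
  unfolding linear_conv_bounded_linear[symmetric]
  by (rule linearI)
    (simp_all add: matrix_vector_mult_add_rdistrib inner_add_right scaleR_matrix_vector_assoc[symmetric])

lemma borel_measurable_matrix_vector_mult:
  fixes f :: "'a \<Rightarrow> real ^ 'n"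
  assumes "f \<in> borel_measurable M"
  shows "(\<lambda>x. (X :: real ^ 'n ^ 'm) *v f x) \<in> borel_measurable M"
  by (rule measurable_compose[OF assms])
    (intro borel_measurable_continuous_onI linear_continuous_on matrix_vector_mul_bounded_linear)

lemma invertible_matrix_inv:
  assumes "invertible M"
  shows "M ** matrix_inv M = mat 1" and "matrix_inv M ** M = mat 1"
  using someI_ex[OF assms[unfolded invertible_def]] by (simp_all add: matrix_inv_def)

section \<open>The frame operator\<close>

text \<open>Testing the upper frame bound on an orthonormal basis and summing gives a finite second
  moment; this is what makes the matrix-valued integral defining the frame operator converge.\<close>

lemma probabilistic_frame_integrable_norm_square:
  assumes "probabilistic_frame \<mu>"
  shows "integrable \<mu> (\<lambda>y. (norm y)\<^sup>2)"
proof -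
  from assms have [measurable_cong]: "sets \<mu> = sets borel"
    by (simp add: probabilistic_frame_def borel_prob_measures_def)
  have comp: "integrable \<mu> (\<lambda>y. (b \<bullet> y)\<^sup>2)" for b
  proof -
    obtain B where "(\<integral>\<^sup>+ y. ennreal (\<bar>b \<bullet> y\<bar>\<^sup>2) \<partial>\<mu>) \<le> ennreal (B * (norm b)\<^sup>2)"
      using assms unfolding probabilistic_frame_def by blast
    then have "(\<integral>\<^sup>+ y. ennreal (\<bar>b \<bullet> y\<bar>\<^sup>2) \<partial>\<mu>) < \<infinity>"
      by (rule le_less_trans) simp
    then show ?thesis
      by (intro integrableI_bounded) simp_all
  qed
  have "(norm y)\<^sup>2 = (\<Sum>b\<in>Basis. (b \<bullet> y)\<^sup>2)" for y :: 'a
    unfolding power2_norm_eq_inner euclidean_inner[of y y] by (simp add: power2_eq_square inner_commute)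
  then show ?thesis
    using comp by simp
qed

lemma integrable_outer_prod_self:
  fixes \<mu> :: "(real ^ 'n) measure"
  assumes "probabilistic_frame \<mu>"
  shows "integrable \<mu> (\<lambda>y. outer_prod y y)"
proof (rule Bochner_Integration.integrable_bound)
  show "integrable \<mu> (\<lambda>y. (norm y)\<^sup>2)"
    by (rule probabilistic_frame_integrable_norm_square[OF assms])
  from assms have [measurable_cong]: "sets \<mu> = sets borel"
    by (simp add: probabilistic_frame_def borel_prob_measures_def)
  have "(\<lambda>y :: real ^ 'n. outer_prod y y) \<in> borel_measurable borel"
    by (rule borel_measurable_continuous_onI[OF continuous_on_outer_prod_self])
  then show "(\<lambda>y. outer_prod y y) \<in> borel_measurable \<mu>"
    by measurable
qed (simp add: norm_outer_prod power2_eq_square)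

lemma frame_operator_bilinear_form:
  fixes \<mu> :: "(real ^ 'n) measure"
  assumes "probabilistic_frame \<mu>"
  shows "integrable \<mu> (\<lambda>y. (u \<bullet> y) * (v \<bullet> y))"
    and "u \<bullet> (frame_operator \<mu> *v v) = (\<integral> y. (u \<bullet> y) * (v \<bullet> y) \<partial>\<mu>)"
proof -
  have "(\<lambda>y. u \<bullet> (outer_prod y y *v v)) = (\<lambda>y. (u \<bullet> y) * (v \<bullet> y))"
    by (simp add: fun_eq_iff outer_prod_mult_vec inner_commute)
  then show "integrable \<mu> (\<lambda>y. (u \<bullet> y) * (v \<bullet> y))"
      and "u \<bullet> (frame_operator \<mu> *v v) = (\<integral> y. (u \<bullet> y) * (v \<bullet> y) \<partial>\<mu>)"
    using integrable_bounded_linear[OF bounded_linear_bilinear_form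
        integrable_outer_prod_self[OF assms], of u v]
      integral_bounded_linear[OF bounded_linear_bilinear_form
        integrable_outer_prod_self[OF assms], of u v]
    by (simp_all add: frame_operator_def)
qed

lemma frame_operator_symmetric:
  assumes "probabilistic_frame \<mu>"
  shows "u \<bullet> (frame_operator \<mu> *v v) = v \<bullet> (frame_operator \<mu> *v u)"
  by (simp add: frame_operator_bilinear_form(2)[OF assms] mult.commute)

lemma nn_integral_inner_square:
  assumes "probabilistic_frame \<mu>"
  shows "(\<integral>\<^sup>+ x. ennreal (\<bar>v \<bullet> x\<bar>\<^sup>2) \<partial>\<mu>) = ennreal (v \<bullet> (frame_operator \<mu> *v v))"
proof -
  have "(\<integral>\<^sup>+ x. ennreal (\<bar>v \<bullet> x\<bar>\<^sup>2) \<partial>\<mu>) = (\<integral>\<^sup>+ x. ennreal ((v \<bullet> x) * (v \<bullet> x)) \<partial>\<mu>)"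
    by (simp add: power2_eq_square inner_commute)
  also have "\<dots> = ennreal (v \<bullet> (frame_operator \<mu> *v v))"
    unfolding frame_operator_bilinear_form(2)[OF assms]
    by (intro nn_integral_eq_integral frame_operator_bilinear_form(1)[OF assms]) simp
  finally show ?thesis .
qed

text \<open>The two frame bounds in real terms: they bound the frame operator below and above as a
  quadratic form.\<close>

lemma frame_operator_bounds:
  assumes "probabilistic_frame \<mu>"
  obtains A B where "0 < A" and "\<And>v. A * (norm v)\<^sup>2 \<le> v \<bullet> (frame_operator \<mu> *v v)"
    and "\<And>v. v \<bullet> (frame_operator \<mu> *v v) \<le> B * (norm v)\<^sup>2"
proof -
  from assms obtain A B where AB: "0 < A" "A \<le> B"
    and bnd: "\<And>x. ennreal (A * (norm x)\<^sup>2) \<le> (\<integral>\<^sup>+ y. ennreal (\<bar>x \<bullet> y\<bar>\<^sup>2) \<partial>\<mu>) \<and>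
      (\<integral>\<^sup>+ y. ennreal (\<bar>x \<bullet> y\<bar>\<^sup>2) \<partial>\<mu>) \<le> ennreal (B * (norm x)\<^sup>2)"
    unfolding probabilistic_frame_def by blast
  have nonneg: "0 \<le> v \<bullet> (frame_operator \<mu> *v v)" for v
    by (simp add: frame_operator_bilinear_form(2)[OF assms])
  show ?thesis
  proof (rule that[OF AB(1)])
    fix v
    show "A * (norm v)\<^sup>2 \<le> v \<bullet> (frame_operator \<mu> *v v)"
      using bnd[of v] nonneg[of v] by (simp only: nn_integral_inner_square[OF assms] ennreal_le_iff)
    have "0 \<le> B * (norm v)\<^sup>2"
      using AB by simp
    then show "v \<bullet> (frame_operator \<mu> *v v) \<le> B * (norm v)\<^sup>2"
      using bnd[of v] by (simp only: nn_integral_inner_square[OF assms] ennreal_le_iff)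
  qed
qed

lemma invertible_frame_operator:
  assumes "probabilistic_frame \<mu>"
  shows "invertible (frame_operator \<mu>)"
proof -
  obtain A where "0 < A" and A: "\<And>v. A * (norm v)\<^sup>2 \<le> v \<bullet> (frame_operator \<mu> *v v)"
    using frame_operator_bounds[OF assms] by metis
  have "x = 0" if "frame_operator \<mu> *v x = 0" for x
  proof -
    have "A * (norm x)\<^sup>2 \<le> 0"
      using A[of x] that by simp
    with \<open>0 < A\<close> show ?thesis
      by (simp add: mult_le_0_iff)
  qed
  then show ?thesis
    by (simp add: invertible_left_inverse matrix_left_invertible_ker)
qed

text \<open>The canonical dual accounts for the constant \<open>n\<close>: the integral is the trace of
  \<open>S\<^sup>-\<^sup>1 S\<close>.\<close>

lemma integral_canonical_dual:
  fixes \<mu> :: "(real ^ 'n) measure"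
  assumes "probabilistic_frame \<mu>"
  shows "integrable \<mu> (\<lambda>y. y \<bullet> (matrix_inv (frame_operator \<mu>) *v y))"
    and "(\<integral> y. y \<bullet> (matrix_inv (frame_operator \<mu>) *v y) \<partial>\<mu>) = real CARD('n)"
proof -
  let ?R = "matrix_inv (frame_operator \<mu>)"
  note bl = bounded_linear_trace_mult[of ?R] and int = integrable_outer_prod_self[OF assms]
  show "integrable \<mu> (\<lambda>y. y \<bullet> (?R *v y))"
    using integrable_bounded_linear[OF bl int] by (simp add: trace_mult_outer_prod)
  have "(\<integral> y. y \<bullet> (?R *v y) \<partial>\<mu>) = trace (?R ** frame_operator \<mu>)"
    using integral_bounded_linear[OF bl int]
    by (simp add: trace_mult_outer_prod frame_operator_def)
  also have "\<dots> = real CARD('n)"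
    by (simp add: invertible_matrix_inv(2)[OF invertible_frame_operator[OF assms]] trace_I)
  finally show "(\<integral> y. y \<bullet> (?R *v y) \<partial>\<mu>) = real CARD('n)" .
qed

section \<open>Dual frames of pushforward type\<close>

text \<open>Taking traces in the duality relation. The matrix-valued integral converges because its
  value is nonzero.\<close>

lemma integral_pushforward_dual:
  fixes \<mu> :: "(real ^ 'n) measure"
  assumes "pushforward_dual_frame \<mu> T"
  shows "integrable \<mu> (\<lambda>y. y \<bullet> T y)" and "(\<integral> y. y \<bullet> T y \<partial>\<mu>) = real CARD('n)"
proof -
  from assms have eq: "(\<integral> x. outer_prod x (T x) \<partial>\<mu>) = mat 1"
    by (simp add: pushforward_dual_frame_def)
  have "(mat 1 :: real ^ 'n ^ 'n) \<noteq> 0"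
    by (auto simp: vec_eq_iff mat_def)
  with eq have int: "integrable \<mu> (\<lambda>x. outer_prod x (T x))"
    using not_integrable_integral_eq by fastforce
  show "integrable \<mu> (\<lambda>y. y \<bullet> T y)"
    using integrable_bounded_linear[OF bounded_linear_trace int] by (simp add: trace_outer_prod)
  show "(\<integral> y. y \<bullet> T y \<partial>\<mu>) = real CARD('n)"
    using integral_bounded_linear[OF bounded_linear_trace int]
    by (simp add: trace_outer_prod eq trace_I)
qed

text \<open>The square is taken in the inner product defined by \<open>S\<close>; symmetry merges the two mixed terms
  into \<open>2 * (y \<bullet> u)\<close>, as \<open>S\<close> cancels its inverse.\<close>

lemma quadratic_form_complete_square:
  fixes S :: "real ^ 'n ^ 'n"
  assumes sym: "\<And>u v. u \<bullet> (S *v v) = v \<bullet> (S *v u)" and "invertible S"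
  shows "u \<bullet> (S *v u) = 2 * (y \<bullet> u) - y \<bullet> (matrix_inv S *v y)
    + (u - matrix_inv S *v y) \<bullet> (S *v (u - matrix_inv S *v y))"
proof -
  have "S *v (matrix_inv S *v y) = y"
    by (simp add: matrix_vector_mul_assoc invertible_matrix_inv(1)[OF assms(2)])
  then show ?thesis
    using sym[of "matrix_inv S *v y" u]
    by (simp add: matrix_vector_mult_diff_distrib inner_diff_left inner_diff_right inner_commute)
qed

theorem theorem3p5:
  fixes \<mu> :: "(real ^ ('n::finite)) measure"
    and T :: "real ^ 'n \<Rightarrow> real ^ 'n"
  assumes "probabilistic_frame \<mu>"
    and "T \<in> borel_measurable borel"
    and "pushforward_dual_frame \<mu> T"
  shows "(\<integral>\<^sup>+ y. (\<integral>\<^sup>+ x. ennreal (\<bar>x \<bullet> T y\<bar>\<^sup>2) \<partial>\<mu>) \<partial>\<mu>) \<ge> of_nat CARD('n) \<and>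
    ((\<integral>\<^sup>+ y. (\<integral>\<^sup>+ x. ennreal (\<bar>x \<bullet> T y\<bar>\<^sup>2) \<partial>\<mu>) \<partial>\<mu>) = of_nat CARD('n) \<longleftrightarrow>
      (AE y in \<mu>. T y = matrix_inv (frame_operator \<mu>) *v y))"
proof -
  note frame = assms(1)
  define S where "S = frame_operator \<mu>"
  define h where "h = (\<lambda>y. T y - matrix_inv S *v y)"
  define q where "q = (\<lambda>y. h y \<bullet> (S *v h y))"
  from frame have [measurable_cong]: "sets \<mu> = sets borel"
    by (simp add: probabilistic_frame_def borel_prob_measures_def)
  have T [measurable]: "T \<in> borel_measurable \<mu>"
    using assms(2) by measurable
  obtain A B where "0 < A" and A: "\<And>v. A * (norm v)\<^sup>2 \<le> v \<bullet> (S *v v)"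
    and B: "\<And>v. v \<bullet> (S *v v) \<le> B * (norm v)\<^sup>2"
    using frame_operator_bounds[OF frame] unfolding S_def by metis
  have S_nonneg: "0 \<le> v \<bullet> (S *v v)" for v
    using A[of v] \<open>0 < A\<close> by (meson less_imp_le mult_nonneg_nonneg order_trans zero_le_power2)
  have q_nonneg: "0 \<le> q y" for y
    by (simp add: q_def S_nonneg)
  have q_zero: "q y = 0 \<longleftrightarrow> T y = matrix_inv S *v y" for y
  proof
    assume "q y = 0"
    with A[of "h y"] \<open>0 < A\<close> have "h y = 0"
      by (simp add: q_def mult_le_0_iff)
    then show "T y = matrix_inv S *v y"
      by (simp add: h_def)
  qed (simp add: q_def h_def)
  \<comment> \<open>The second moment of the dual and the upper frame bound make the potential finite, so that
    the completed square can be integrated term by term over the reals.\<close>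
  have "integrable \<mu> (\<lambda>y. (norm (T y))\<^sup>2)"
  proof (rule integrableI_bounded)
    have "(\<integral>\<^sup>+ x. ennreal ((norm x)\<^sup>2) \<partial>distr \<mu> borel T) < \<infinity>"
      using assms(3) by (simp add: pushforward_dual_frame_def borel_prob_measures2_def)
    then show "(\<integral>\<^sup>+ y. ennreal (norm ((norm (T y))\<^sup>2)) \<partial>\<mu>) < \<infinity>"
      by (simp add: nn_integral_distr)
  qed measurable
  then have "integrable \<mu> (\<lambda>y. B * (norm (T y))\<^sup>2)"
    by simp
  then have T_int: "integrable \<mu> (\<lambda>y. T y \<bullet> (S *v T y))"
  proof (rule Bochner_Integration.integrable_bound)
    show "(\<lambda>y. T y \<bullet> (S *v T y)) \<in> borel_measurable \<mu>"
      by (intro borel_measurable_inner borel_measurable_matrix_vector_mult T)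
    show "AE y in \<mu>. norm (T y \<bullet> (S *v T y)) \<le> norm (B * (norm (T y))\<^sup>2)"
      using B S_nonneg by (intro AE_I2) (smt (verit) real_norm_def)
  qed
  have square: "T y \<bullet> (S *v T y) = 2 * (y \<bullet> T y) - y \<bullet> (matrix_inv S *v y) + q y" for y
    unfolding q_def h_def S_def
    by (rule quadratic_form_complete_square[OF frame_operator_symmetric[OF frame]
          invertible_frame_operator[OF frame]])
  note dual = integral_pushforward_dual[OF assms(3)]
    and canonical = integral_canonical_dual[OF frame, folded S_def]
  have q_eq: "q = (\<lambda>y. T y \<bullet> (S *v T y) - (2 * (y \<bullet> T y) - y \<bullet> (matrix_inv S *v y)))"
    by (simp add: square fun_eq_iff)
  have q_int: "integrable \<mu> q"
    unfolding q_eq using T_int dual(1) canonical(1) by simp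
  have q_integral: "(\<integral> y. T y \<bullet> (S *v T y) \<partial>\<mu>) = real CARD('n) + (\<integral> y. q y \<partial>\<mu>)"
    unfolding square using q_int dual canonical by simp
  have q_integral_nonneg: "0 \<le> (\<integral> y. q y \<partial>\<mu>)"
    by (simp add: q_nonneg)
  have "(\<integral>\<^sup>+ y. (\<integral>\<^sup>+ x. ennreal (\<bar>x \<bullet> T y\<bar>\<^sup>2) \<partial>\<mu>) \<partial>\<mu>) = (\<integral>\<^sup>+ y. ennreal (T y \<bullet> (S *v T y)) \<partial>\<mu>)"
    by (simp only: nn_integral_inner_square[OF frame, folded S_def] inner_commute[of _ "T _"])
  also have "\<dots> = ennreal (\<integral> y. T y \<bullet> (S *v T y) \<partial>\<mu>)"
    by (rule nn_integral_eq_integral[OF T_int]) (simp add: S_nonneg)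
  also have "\<dots> = of_nat CARD('n) + ennreal (\<integral> y. q y \<partial>\<mu>)"
    by (simp add: q_integral q_integral_nonneg ennreal_plus ennreal_of_nat_eq_real_of_nat)
  finally have PDFP: "(\<integral>\<^sup>+ y. (\<integral>\<^sup>+ x. ennreal (\<bar>x \<bullet> T y\<bar>\<^sup>2) \<partial>\<mu>) \<partial>\<mu>) =
    of_nat CARD('n) + ennreal (\<integral> y. q y \<partial>\<mu>)" .
  have "(of_nat CARD('n) + ennreal (\<integral> y. q y \<partial>\<mu>) = of_nat CARD('n)) \<longleftrightarrow> (\<integral> y. q y \<partial>\<mu>) = 0"
    using q_integral_nonneg
    by (simp add: ennreal_of_nat_eq_real_of_nat ennreal_plus[symmetric] del: ennreal_plus)
  also have "\<dots> \<longleftrightarrow> (AE y in \<mu>. T y = matrix_inv S *v y)"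
    by (simp add: integral_nonneg_eq_0_iff_AE[OF q_int] q_nonneg q_zero)
  finally show ?thesis
    unfolding PDFP S_def by (simp add: add_increasing2)
qed

end
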